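(* Let $n$ and $d$ be integers with $1\le d\le n$ and $d$ even. Then $$A(n,d)\le \frac{2^{n-1}}{\sum_{i=0}^{\frac{d-2}{2}}\binom{n-1}{i}}.$$
   Context: $A(n,d)$ denotes the maximum number of codewords in a binary code of length $n$ (a subset of $\{0,1\}^n$) in which any two distinct codewords have Hamming distance at least $d$. The Hamming distance of two sequences is the number of positions in which they differ. *)

theory Defs
  imports Complex_Main
begin

definition hamming_dist :: "'a list \<Rightarrow> 'a list \<Rightarrow> nat" where
  "hamming_dist x y = card {i. i < length x \<and> x ! i \<noteq> y ! i}"
  (* intended for lists of equal length only *)

definition binary_words :: "nat \<Rightarrow> bool list set" where
  "binary_words n = {x. length x = n}"

definition is_code :: "nat \<Rightarrow> nat \<Rightarrow> bool list set \<Rightarrow> bool" where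
  "is_code n d C \<longleftrightarrow>
     C \<subseteq> binary_words n \<and> pairwise (\<lambda>x y. d \<le> hamming_dist x y) C"

definition A :: "nat \<Rightarrow> nat \<Rightarrow> nat" where
  "A n d = Max {card C | C. is_code n d C}"

lemma finite_binary_words: "finite (binary_words n)"
  using finite_lists_length_eq[of "UNIV :: bool set" n] by (simp add: binary_words_def)

(* The maximum in the definition of A ranges over a finite nonempty set, so it is attained. *)
lemma finite_code_sizes: "finite {card C | C. is_code n d C}"
proof (rule finite_subset)
  show "{card C | C. is_code n d C} \<subseteq> card ` Pow (binary_words n)"
    by (auto simp: is_code_def)
  show "finite (card ` Pow (binary_words n))"
    by (simp add: finite_binary_words)
qed

lemma code_sizes_nonempty: "{card C | C. is_code n d C} \<noteq> {}"
proof -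
  have "is_code n d {}" by (simp add: is_code_def)
  then show ?thesis by blast
qed

end

theory Submission
  imports Defs
begin

text \<open>Deleting the first letter of each codeword lowers distances by at most one, so the punctured
  words have pairwise distance at least \<open>d - 1 = 2t + 1\<close> with \<open>t = (d - 2) / 2\<close>. Hence the
  balls of radius \<open>t\<close> around them are disjoint subsets of the words of length \<open>n - 1\<close>
  (the sphere-packing bound).\<close>

lemma hamming_dist_Nil [simp]: "hamming_dist [] y = 0"
  by (simp add: hamming_dist_def)

text \<open>Index 0 accounts for the heads, and the remaining indices are those of the tails shifted
  by \<open>Suc\<close>. This recursion opens the index-based definition to list induction.\<close>

lemma hamming_dist_Cons [simp]:
  "hamming_dist (x # xs) (y # ys) = of_bool (x \<noteq> y) + hamming_dist xs ys"
proof -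
  have "{i. i < length (x # xs) \<and> (x # xs) ! i \<noteq> (y # ys) ! i}
      = (if x \<noteq> y then {0} else {}) \<union> Suc ` {i. i < length xs \<and> xs ! i \<noteq> ys ! i}"
    by (auto simp: less_Suc_eq_0_disj)
  then show ?thesis
    by (simp add: hamming_dist_def card_image card_insert_if)
qed

lemma hamming_dist_commute:
  "length x = length y \<Longrightarrow> hamming_dist x y = hamming_dist y x"
  unfolding hamming_dist_def by metis

lemma hamming_dist_triangle:
  assumes "length x = length y" "length y = length z"
  shows "hamming_dist x z \<le> hamming_dist x y + hamming_dist y z"
  using assms by (induction x y z rule: list_induct3) auto

lemma hamming_dist_le_tl:
  assumes "length x = length y"
  shows "hamming_dist x y \<le> Suc (hamming_dist (tl x) (tl y))"
  using assms by (cases x; cases y) auto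

text \<open>Pascal's rule: a word at distance \<open>Suc j\<close> from \<open>a # x\<close> either
  keeps \<open>a\<close> and differs from \<open>x\<close> in \<open>Suc j\<close> places of the
  tail, or flips \<open>a\<close> and differs in \<open>j\<close> places.\<close>

lemma card_hamming_sphere:
  fixes x :: "bool list"
  shows "card {y. length y = length x \<and> hamming_dist x y = k} = length x choose k"
proof (induction x arbitrary: k)
  case Nil
  have "{y :: bool list. length y = 0 \<and> 0 = k} = (if k = 0 then {[]} else {})"
    by auto
  then show ?case by (cases k) auto
next
  case (Cons a x)
  let ?S = "\<lambda>k. {y. length y = length x \<and> hamming_dist x y = k}"
  have fin: "finite (?S k)" for k
    using finite_binary_words[of "length x"] by (simp add: binary_words_def)
  show ?case
  proof (cases k)
    case 0
    have "{y. length y = length (a # x) \<and> hamming_dist (a # x) y = k} = Cons a ` ?S 0"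
      using 0 by (auto simp: length_Suc_conv)
    then show ?thesis
      using 0 Cons.IH[of 0] by (simp add: card_image)
  next
    case (Suc j)
    have "{y. length y = length (a # x) \<and> hamming_dist (a # x) y = k}
        = Cons a ` ?S (Suc j) \<union> Cons (\<not> a) ` ?S j"
      using Suc by (auto simp: length_Suc_conv image_iff of_bool_def split: if_splits)
    moreover have "Cons a ` ?S (Suc j) \<inter> Cons (\<not> a) ` ?S j = {}"
      by auto
    ultimately show ?thesis
      using Suc Cons.IH[of j] Cons.IH[of "Suc j"] fin by (simp add: card_Un_disjoint card_image)
  qed
qed

text \<open>The length condition keeps the ball finite, as \<open>hamming_dist x y\<close> ignores
  the positions of \<open>y\<close> beyond the end of \<open>x\<close>.\<close>

definition hamming_ball :: "bool list \<Rightarrow> nat \<Rightarrow> bool list set" where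
  "hamming_ball x t = {y. length y = length x \<and> hamming_dist x y \<le> t}"

lemma hamming_ball_subset: "hamming_ball x t \<subseteq> binary_words (length x)"
  by (auto simp: hamming_ball_def binary_words_def)

lemma finite_hamming_ball: "finite (hamming_ball x t)"
  using finite_subset[OF hamming_ball_subset finite_binary_words] .

lemma card_hamming_ball: "card (hamming_ball x t) = (\<Sum>i = 0..t. length x choose i)"
proof -
  let ?S = "\<lambda>k. {y. length y = length x \<and> hamming_dist x y = k}"
  have "hamming_ball x t = (\<Union>i\<in>{0..t}. ?S i)"
    by (auto simp: hamming_ball_def)
  moreover have "card (\<Union>i\<in>{0..t}. ?S i) = (\<Sum>i = 0..t. card (?S i))"
    using finite_binary_words[of "length x"]
    by (intro card_UN_disjoint) (auto simp: binary_words_def)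
  ultimately show ?thesis
    by (simp add: card_hamming_sphere)
qed

lemma card_binary_words: "card (binary_words n) = 2 ^ n"
  using card_lists_length_eq[of "UNIV :: bool set" n] by (simp add: binary_words_def)

text \<open>By the triangle inequality, a common word would put the centres within distance
  \<open>2 * t\<close>.\<close>

lemma disjoint_hamming_balls:
  assumes "length x = length y" "2 * t < hamming_dist x y"
  shows "hamming_ball x t \<inter> hamming_ball y t = {}"
proof (rule ccontr)
  assume "hamming_ball x t \<inter> hamming_ball y t \<noteq> {}"
  then obtain z where z: "length z = length x" "hamming_dist x z \<le> t" "hamming_dist y z \<le> t"
    by (auto simp: hamming_ball_def)
  have "hamming_dist x y \<le> hamming_dist x z + hamming_dist z y"
    using z assms(1) by (intro hamming_dist_triangle) auto
  moreover have "hamming_dist z y = hamming_dist y z"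
    using z assms(1) by (intro hamming_dist_commute) auto
  ultimately show False
    using z assms(2) by linarith
qed

lemma punctured_sphere_packing:
  assumes "is_code n d C" and "2 * t + 2 \<le> d"
  shows "card C * (\<Sum>i = 0..t. (n - 1) choose i) \<le> 2 ^ (n - 1)"
proof -
  have len: "length c = n" if "c \<in> C" for c
    using assms(1) that by (auto simp: is_code_def binary_words_def)
  have "finite C"
    using assms(1) finite_subset[OF _ finite_binary_words] by (auto simp: is_code_def)
  moreover have "hamming_ball (tl x) t \<inter> hamming_ball (tl y) t = {}"
    if "x \<in> C" "y \<in> C" "x \<noteq> y" for x y
  proof (rule disjoint_hamming_balls)
    have "d \<le> hamming_dist x y"
      using assms(1) that by (auto simp: is_code_def pairwise_def)
    then show "2 * t < hamming_dist (tl x) (tl y)"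
      using hamming_dist_le_tl[of x y] len that assms(2) by simp
  qed (use len that in simp)
  \<comment> \<open>Indexing by \<open>C\<close> rather than by the punctured words yields the
    factor \<open>card C\<close> without a separate proof that \<open>tl\<close> is injective on
    \<open>C\<close>.\<close>
  ultimately have "card (\<Union>c\<in>C. hamming_ball (tl c) t) = (\<Sum>c\<in>C. card (hamming_ball (tl c) t))"
    by (intro card_UN_disjoint) (auto simp: finite_hamming_ball)
  also have "\<dots> = card C * (\<Sum>i = 0..t. (n - 1) choose i)"
    by (simp add: card_hamming_ball len)
  finally have "card C * (\<Sum>i = 0..t. (n - 1) choose i) = card (\<Union>c\<in>C. hamming_ball (tl c) t)" ..
  also have "\<dots> \<le> card (binary_words (n - 1))"
    using len by (intro card_mono finite_binary_words) (auto simp: hamming_ball_def binary_words_def)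
  finally show ?thesis
    by (simp add: card_binary_words)
qed

theorem lemma5:
  fixes n d :: nat
  assumes "1 \<le> d" and "d \<le> n" and "even d"
  shows "real (A n d) \<le> 2 ^ (n - 1) / (\<Sum>i = 0..(d - 2) div 2. real ((n - 1) choose i))"
proof -
  let ?t = "(d - 2) div 2"
  obtain C where C: "is_code n d C" "A n d = card C"
    using Max_in[OF finite_code_sizes code_sizes_nonempty, of n d] by (auto simp: A_def)
  \<comment> \<open>A positive even \<open>d\<close> is at least 2, so the truncated subtraction
    \<open>d - 2\<close> is exact and so is its half.\<close>
  have "2 * ?t + 2 \<le> d"
    using assms by (auto elim!: evenE)
  then have "card C * (\<Sum>i = 0..?t. (n - 1) choose i) \<le> 2 ^ (n - 1)"
    by (rule punctured_sphere_packing[OF C(1)])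
  then have "real (card C * (\<Sum>i = 0..?t. (n - 1) choose i)) \<le> real (2 ^ (n - 1))"
    by (rule of_nat_mono)
  then have "real (A n d) * (\<Sum>i = 0..?t. real ((n - 1) choose i)) \<le> 2 ^ (n - 1)"
    by (simp add: C(2))
  \<comment> \<open>The term at \<open>i = 0\<close> is 1, which makes the sum positive and allows
    dividing by it.\<close>
  moreover have "0 < (\<Sum>i = 0..?t. real ((n - 1) choose i))"
    by (rule sum_pos2[of _ 0]) auto
  ultimately show ?thesis
    by (simp add: pos_le_divide_eq)
qed

end
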